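(* Let $(X_i,A_i,F_i,\mathcal{C}_i)_{i\in N}$ be a generalized game in choice form, and assume that for each $(x,y)\in X\times X$ there exists $i\in N$ such that $\mathcal{C}_i(x_{-i},y_{-i})\neq\emptyset$. Assume that, for each $i\in N$, the following conditions are fulfilled: a) $X_i$ is a nonempty, convex and compact set in a Hausdorff locally convex space $E_i$; b) $W_i=\{(x_{-i},y_{-i})\in X_{-i}\times X_{-i}: (A_i(x_{-i})\times F_i(y_{-i}))\cap \mathcal{C}_i(x_{-i},y_{-i})\neq\emptyset\}$ is nonempty and closed; c) $\mathcal{C}_i(x_i,y_i)$ is open (in $X_{-i}\times X_{-i}$) for each $(x_i,y_i)\in X_i\times X_i$; d) $\mathcal{C}_i(x_{-i},y_{-i})$ is convex or empty for each $(x_{-i},y_{-i})\in X_{-i}\times X_{-i}$. Then the game admits an equilibrium in choice, i.e. there exists $(x^*,y^* )\in X\times X$ such that for every $i\in N$: if $\big(\{x^*_{-i}\}\times A_i(x^*_{-i})\big)\times\big(\{y^*_{-i}\}\times F_i(y^*_{-i})\big)$ meets $\mathcal{C}_i$, then $(x^*,y^* )\in\mathcal{C}_i$.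
   Context: $N=\{1,\dots,n\}$ is a finite set of players, $(X_i)_{i\in N}$ is the family of individual strategy sets, $X=\prod_{i\in N}X_i$, $X_{-i}=\prod_{j\neq i}X_j$, and for $x\in X$, $x_{-i}=(x_1,\dots,x_{i-1},x_{i+1},\dots,x_n)$; one writes $x=(x_{-i},x_i)$, identifying $X$ with $X_{-i}\times X_i$. A correspondence is a set-valued map. For each $i$, $A_i:X_{-i}\to 2^{X_i}$ and $F_i:X_{-i}\to 2^{X_i}$ are (constraint) correspondences, with graphs $\mathrm{Gr}\,A_i,\mathrm{Gr}\,F_i\subset X_{-i}\times X_i= X$. A choice profile under restrictions is a collection $(\mathcal{C}_i)_{i\in N}$ of nonempty subsets of $X\times X$ with $\mathcal{C}_i\subset \mathrm{Gr}\,A_i\times\mathrm{Gr}\,F_i$ for each $i\in N$. A generalized game in choice form is a family $((X_i)_{i\in N},(A_i)_{i\in N},(F_i)_{i\in N},(\mathcal{C}_i)_{i\in N})$ where $(\mathcal{C}_i)_{i\in N}$ is a choice profile under restrictions. Sections: for $(x_{-i},y_{-i})\in X_{-i}\times X_{-i}$, $\mathcal{C}_i(x_{-i},y_{-i})=\{(x_i,y_i)\in X_i\times X_i:((x_{-i},x_i),(y_{-i},y_i))\in\mathcal{C}_i\}$; for $(x_i,y_i)\in X_i\times X_i$, $\mathcal{C}_i(x_i,y_i)=\{(x_{-i},y_{-i})\in X_{-i}\times X_{-i}:((x_{-i},x_i),(y_{-i},y_i))\in\mathcal{C}_i\}$. *)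

theory Defs
  imports "HOL-Analysis.Analysis"
begin

text \<open>
  The topology is a parameter and not a type class instance, so that every player may have a
  space of their own: each \<open>E\<^sub>i\<close> is a linear subspace \<open>topspace T\<close> of one ambient real vector
  space without topology. Any family of real vector spaces embeds in this way into its direct sum,
  and \<open>T\<close> need not be induced by anything on the ambient space.
\<close>

definition hausdorff_locally_convex_space :: "'e::real_vector topology \<Rightarrow> bool" where
  "hausdorff_locally_convex_space T \<longleftrightarrow>
     subspace (topspace T) \<and>
     continuous_map (prod_topology T T) T (\<lambda>(x, y). x + y) \<and>
     continuous_map (prod_topology euclideanreal T) T (\<lambda>(r, x). r *\<^sub>R x) \<and>
     Hausdorff_space T \<and>
     (\<forall>U. openin T U \<and> 0 \<in> U \<longrightarrow> (\<exists>V. openin T V \<and> convex V \<and> 0 \<in> V \<and> V \<subseteq> U))"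

text \<open>
  Strategy profiles are extensional functions on \<open>{1..n}\<close>, and profiles of the opponents of
  player \<open>i\<close> are extensional functions on \<open>{1..n} - {i}\<close>. Thus \<open>z(i := a)\<close> is the profile
  \<open>(z, a)\<close> obtained from an opponents' profile \<open>z\<close> and a strategy \<open>a\<close> of player \<open>i\<close>.
\<close>

definition profiles :: "nat \<Rightarrow> (nat \<Rightarrow> 'e set) \<Rightarrow> (nat \<Rightarrow> 'e) set" where
  "profiles n X = (\<Pi>\<^sub>E j\<in>{1..n}. X j)"

definition opp_profiles :: "nat \<Rightarrow> (nat \<Rightarrow> 'e set) \<Rightarrow> nat \<Rightarrow> (nat \<Rightarrow> 'e) set" where
  "opp_profiles n X i = (\<Pi>\<^sub>E j\<in>{1..n} - {i}. X j)"

definition opp :: "nat \<Rightarrow> nat \<Rightarrow> (nat \<Rightarrow> 'e) \<Rightarrow> nat \<Rightarrow> 'e" where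
  "opp n i x = restrict x ({1..n} - {i})"

definition opp_topology ::
    "nat \<Rightarrow> (nat \<Rightarrow> 'e topology) \<Rightarrow> (nat \<Rightarrow> 'e set) \<Rightarrow> nat \<Rightarrow> (nat \<Rightarrow> 'e) topology" where
  "opp_topology n T X i = product_topology (\<lambda>j. subtopology (T j) (X j)) ({1..n} - {i})"

definition graph_of ::
    "nat \<Rightarrow> (nat \<Rightarrow> 'e set) \<Rightarrow> nat \<Rightarrow> ((nat \<Rightarrow> 'e) \<Rightarrow> 'e set) \<Rightarrow> (nat \<Rightarrow> 'e) set" where
  "graph_of n X i B = {x \<in> profiles n X. x i \<in> B (opp n i x)}"

definition generalized_game_in_choice_form ::
    "nat \<Rightarrow> (nat \<Rightarrow> 'e set) \<Rightarrow> (nat \<Rightarrow> (nat \<Rightarrow> 'e) \<Rightarrow> 'e set) \<Rightarrow>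
     (nat \<Rightarrow> (nat \<Rightarrow> 'e) \<Rightarrow> 'e set) \<Rightarrow> (nat \<Rightarrow> ((nat \<Rightarrow> 'e) \<times> (nat \<Rightarrow> 'e)) set) \<Rightarrow> bool" where
  "generalized_game_in_choice_form n X A F C \<longleftrightarrow>
     (\<forall>i\<in>{1..n}.
        (\<forall>z\<in>opp_profiles n X i. A i z \<subseteq> X i \<and> F i z \<subseteq> X i) \<and>
        C i \<noteq> {} \<and>
        C i \<subseteq> profiles n X \<times> profiles n X \<and>
        C i \<subseteq> graph_of n X i (A i) \<times> graph_of n X i (F i))"

definition section_at_opp ::
    "(nat \<Rightarrow> 'e set) \<Rightarrow> (nat \<Rightarrow> ((nat \<Rightarrow> 'e) \<times> (nat \<Rightarrow> 'e)) set) \<Rightarrow> nat \<Rightarrow>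
     (nat \<Rightarrow> 'e) \<Rightarrow> (nat \<Rightarrow> 'e) \<Rightarrow> ('e \<times> 'e) set" where
  "section_at_opp X C i z w = {(a, b) \<in> X i \<times> X i. (z(i := a), w(i := b)) \<in> C i}"

definition section_at_own ::
    "nat \<Rightarrow> (nat \<Rightarrow> 'e set) \<Rightarrow> (nat \<Rightarrow> ((nat \<Rightarrow> 'e) \<times> (nat \<Rightarrow> 'e)) set) \<Rightarrow> nat \<Rightarrow>
     'e \<Rightarrow> 'e \<Rightarrow> ((nat \<Rightarrow> 'e) \<times> (nat \<Rightarrow> 'e)) set" where
  "section_at_own n X C i a b =
     {(z, w) \<in> opp_profiles n X i \<times> opp_profiles n X i. (z(i := a), w(i := b)) \<in> C i}"

definition choice_domain ::
    "nat \<Rightarrow> (nat \<Rightarrow> 'e set) \<Rightarrow> (nat \<Rightarrow> (nat \<Rightarrow> 'e) \<Rightarrow> 'e set) \<Rightarrow>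
     (nat \<Rightarrow> (nat \<Rightarrow> 'e) \<Rightarrow> 'e set) \<Rightarrow> (nat \<Rightarrow> ((nat \<Rightarrow> 'e) \<times> (nat \<Rightarrow> 'e)) set) \<Rightarrow>
     nat \<Rightarrow> ((nat \<Rightarrow> 'e) \<times> (nat \<Rightarrow> 'e)) set" where
  "choice_domain n X A F C i =
     {(z, w) \<in> opp_profiles n X i \<times> opp_profiles n X i.
        (A i z \<times> F i w) \<inter> section_at_opp X C i z w \<noteq> {}}"

definition equilibrium_in_choice ::
    "nat \<Rightarrow> (nat \<Rightarrow> 'e set) \<Rightarrow> (nat \<Rightarrow> (nat \<Rightarrow> 'e) \<Rightarrow> 'e set) \<Rightarrow>
     (nat \<Rightarrow> (nat \<Rightarrow> 'e) \<Rightarrow> 'e set) \<Rightarrow> (nat \<Rightarrow> ((nat \<Rightarrow> 'e) \<times> (nat \<Rightarrow> 'e)) set) \<Rightarrow>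
     (nat \<Rightarrow> 'e) \<Rightarrow> (nat \<Rightarrow> 'e) \<Rightarrow> bool" where
  "equilibrium_in_choice n X A F C x y \<longleftrightarrow>
     x \<in> profiles n X \<and> y \<in> profiles n X \<and>
     (\<forall>i\<in>{1..n}.
        (((\<lambda>a. (opp n i x)(i := a)) ` A i (opp n i x)) \<times>
         ((\<lambda>b. (opp n i y)(i := b)) ` F i (opp n i y))) \<inter> C i \<noteq> {}
        \<longrightarrow> (x, y) \<in> C i)"

end

theory Submission
  imports Defs
begin

text \<open>
  The domain of every player \<open>i\<close>, the set of pairs of opponents' profiles at which \<open>C i\<close> offers an
  admissible choice, is closed by assumption. It is also open, since it is the union of the sections
  of \<open>C i\<close> at the own strategies of \<open>i\<close> (\<open>choice_domain_eq_Union\<close>). The opponents' profiles form a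
  product of convex sets, which is connected; so the nonempty domain is everything, and \<open>C i\<close> has a
  nonempty convex section at every pair of opponents' profiles (\<open>section_at_opp_nonempty\<close>).

  An equilibrium can therefore be found by solving \<open>(x, y) \<in> C i\<close> for all players \<open>i\<close> at once. Regard
  \<open>(x i, y i)\<close> as one strategy \<open>v i\<close> in the convex compact set \<open>X i \<times> X i\<close>, and let \<open>G i v\<close> be the
  section of \<open>C i\<close> at the opponents' parts of \<open>(x, y)\<close>. The task is to find \<open>v\<close> with \<open>v i \<in> G i v\<close>
  for all \<open>i\<close>. The values of \<open>G\<close> are nonempty and convex, and for a given pair of strategies the set
  of \<open>v\<close> at which \<open>G i v\<close> contains it is open. This is the situation of Browder's fixed point
  theorem (\<open>browder_fixed_point_product\<close>).

  Browder's theorem reduces by compactness to an open cover of a simplex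
  (\<open>simplex_open_cover_point\<close>), and from there by a partition of unity to Brouwer's theorem, here
  in the form that continuous self-maps of the Hilbert cube have fixed points
  (\<open>hilbert_cube_fixed_point\<close>), a consequence of Kuhn's combinatorial lemma.
\<close>

section \<open>A fixed point theorem for the Hilbert cube\<close>

text \<open>The compactness argument for Browder's theorem needs Brouwer's theorem in a dimension that it
only finds on the way, namely the size of a finite subcover. The Hilbert cube contains the cubes of
all dimensions in a single type.\<close>

definition hilbert_cube :: "(nat \<Rightarrow> real) set" where
  "hilbert_cube = {x. \<forall>i. 0 \<le> x i \<and> x i \<le> 1}"

lemma tendsto_coordinatewise_iff:
  fixes l :: "'i \<Rightarrow> 'b::topological_space"
  shows "(f \<longlongrightarrow> l) F \<longleftrightarrow> (\<forall>i. ((\<lambda>n. f n i) \<longlongrightarrow> l i) F)"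
  using limitin_componentwise[of "\<lambda>_. euclidean" UNIV f l F]
  by (simp add: euclidean_product_topology)

lemma compact_hilbert_cube: "compact hilbert_cube"
proof -
  have "hilbert_cube = (\<Pi>\<^sub>E i\<in>UNIV. {0..1})" by (auto simp: hilbert_cube_def PiE_def)
  then show ?thesis
    using compactin_PiE[of "\<lambda>_::nat. euclideanreal" UNIV "\<lambda>_. {0..1}"]
    by (simp add: euclidean_product_topology)
qed

text \<open>For a continuous \<open>f\<close>, points \<open>r\<close> and \<open>s\<close> near \<open>z\<close> that coordinate \<open>i\<close> of \<open>f\<close> moves up and down
respectively force \<open>f z i\<close> to be close to \<open>z i\<close>.\<close>

definition straddles ::
    "((nat \<Rightarrow> real) \<Rightarrow> nat \<Rightarrow> real) \<Rightarrow> nat \<Rightarrow> nat \<Rightarrow> (nat \<Rightarrow> real) \<Rightarrow> (nat \<Rightarrow> real) \<Rightarrow> (nat \<Rightarrow> real) \<Rightarrow> bool"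
  where "straddles f p i z r s \<longleftrightarrow> r \<in> hilbert_cube \<and> s \<in> hilbert_cube \<and>
    (\<forall>j. \<bar>r j - z j\<bar> \<le> 1 / p) \<and> (\<forall>j. \<bar>s j - z j\<bar> \<le> 1 / p) \<and> r i \<le> f r i \<and> f s i \<le> s i"

text \<open>Kuhn's combinatorial lemma on the grid of mesh \<open>1 / p\<close> in the first \<open>p\<close> coordinates: every
one of these coordinates sees both labels in a single grid cell. All other coordinates
are \<open>0\<close>, so the number of active coordinates grows together with the fineness of the grid.\<close>

lemma hilbert_cube_straddle:
  assumes f: "\<And>x. x \<in> hilbert_cube \<Longrightarrow> f x \<in> hilbert_cube"
  shows "\<exists>z\<in>hilbert_cube. \<forall>i<p. \<exists>r s. straddles f p i z r s"
proof (cases "p = 0")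
  case True
  then show ?thesis by (auto simp: hilbert_cube_def)
next
  case False
  define pt :: "(nat \<Rightarrow> nat) \<Rightarrow> nat \<Rightarrow> real" where
    "pt x = (\<lambda>j. if j < p then x j / p else 0)" for x
  \<comment> \<open>Kuhn's lemma prescribes the labels on the faces \<open>x i = 0\<close> and \<open>x i = p\<close>. There the defining
    inequality of the label holds anyway, since \<open>f\<close> maps into the cube.\<close>
  define lab :: "(nat \<Rightarrow> nat) \<Rightarrow> nat \<Rightarrow> nat" where
    "lab x i = (if x i = p then 1 else if x i = 0 then 0 else if pt x i \<le> f (pt x) i then 0 else 1)" for x i
  have pt: "pt x \<in> hilbert_cube" if "\<forall>i<p. x i \<le> p" for x
    using that False by (auto simp: pt_def hilbert_cube_def)
  have lab: "(lab x i = 0 \<longrightarrow> pt x i \<le> f (pt x) i) \<and> (lab x i = 1 \<longrightarrow> f (pt x) i \<le> pt x i)"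
    if "\<forall>i<p. x i \<le> p" "i < p" for x i
    using f[OF pt[OF that(1)]] that(2) False by (auto simp: lab_def pt_def hilbert_cube_def)
  obtain q where q: "\<forall>i<p. q i < p"
    and rs: "\<forall>i<p. \<exists>r s. (\<forall>j<p. q j \<le> r j \<and> r j \<le> q j + 1) \<and>
               (\<forall>j<p. q j \<le> s j \<and> s j \<le> q j + 1) \<and> lab r i \<noteq> lab s i"
    by (rule kuhn_lemma[of p p lab]) (use False in \<open>auto simp: lab_def\<close>)
  have near: "\<bar>pt r j - pt q j\<bar> \<le> 1 / p" if "\<forall>j<p. q j \<le> r j \<and> r j \<le> q j + 1" for r j
  proof (cases "j < p")
    case True
    then have "\<bar>real (r j) - real (q j)\<bar> \<le> 1" using that by force
    then have "\<bar>real (r j) - real (q j)\<bar> / p \<le> 1 / p" by (rule divide_right_mono) simp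
    then show ?thesis using True by (simp add: pt_def flip: diff_divide_distrib)
  qed (simp add: pt_def)
  show ?thesis
  proof (rule bexI[of _ "pt q"]; (intro allI impI)?)
    show "pt q \<in> hilbert_cube" using q by (intro pt) (auto intro: less_imp_le)
  next
    fix i assume i: "i < p"
    from rs i obtain r s where r: "\<forall>j<p. q j \<le> r j \<and> r j \<le> q j + 1"
      and s: "\<forall>j<p. q j \<le> s j \<and> s j \<le> q j + 1" and ne: "lab r i \<noteq> lab s i" by blast
    have grid: "\<forall>j<p. r j \<le> p" "\<forall>j<p. s j \<le> p"
      using r s q by fastforce+
    have "lab r i = 0 \<and> lab s i = 1 \<or> lab r i = 1 \<and> lab s i = 0"
      using ne by (auto simp: lab_def split: if_splits)
    then have "straddles f p i (pt q) (pt r) (pt s) \<or> straddles f p i (pt q) (pt s) (pt r)"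
      unfolding straddles_def
      using pt[OF grid(1)] pt[OF grid(2)] near[OF r] near[OF s] lab[OF grid(1) i] lab[OF grid(2) i]
      by (elim disjE) simp_all
    then show "\<exists>r s. straddles f p i (pt q) r s" by blast
  qed
qed

text \<open>Let the mesh go to \<open>0\<close> along a subsequence for which the cells shrink to a point \<open>x\<close>. A
fixed coordinate \<open>i\<close> is active at all late stages, and there the two points that straddle it
both tend to \<open>x\<close>; continuity gives \<open>x i \<le> f x i\<close> and \<open>f x i \<le> x i\<close>.\<close>

theorem hilbert_cube_fixed_point:
  fixes f :: "(nat \<Rightarrow> real) \<Rightarrow> nat \<Rightarrow> real"
  assumes cont: "continuous_on hilbert_cube f"
    and f: "\<And>x. x \<in> hilbert_cube \<Longrightarrow> f x \<in> hilbert_cube"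
  obtains x where "x \<in> hilbert_cube" "f x = x"
proof -
  obtain z where z: "\<And>p. z p \<in> hilbert_cube"
    and near: "\<And>p i. i < p \<Longrightarrow> \<exists>r s. straddles f p i (z p) r s"
    using hilbert_cube_straddle[of f, OF f] by metis
  obtain x \<sigma> where x: "x \<in> hilbert_cube" and \<sigma>: "strict_mono \<sigma>" and lim: "(z \<circ> \<sigma>) \<longlonglongrightarrow> x"
    using compact_hilbert_cube[unfolded compact_def, rule_format, of z] z by blast
  have "f x i = x i" for i
  proof -
    \<comment> \<open>The shift by \<open>Suc i\<close> makes coordinate \<open>i\<close> active at every stage.\<close>
    define \<tau> where "\<tau> k = \<sigma> (k + Suc i)" for k
    have \<tau>: "i < \<tau> k" "k \<le> \<tau> k" for k
      using strict_mono_imp_increasing[OF \<sigma>, of "k + Suc i"] by (auto simp: \<tau>_def)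
    have limz: "(\<lambda>k. z (\<tau> k) j) \<longlonglongrightarrow> x j" for j
      using LIMSEQ_ignore_initial_segment[OF lim, of "Suc i"]
      by (simp add: tendsto_coordinatewise_iff \<tau>_def)
    obtain r s where rs: "\<And>k. straddles f (\<tau> k) i (z (\<tau> k)) (r k) (s k)"
      using near[OF \<tau>(1)] by metis
    then have r: "\<And>k. r k \<in> hilbert_cube" and s: "\<And>k. s k \<in> hilbert_cube"
      and nr: "\<And>k j. \<bar>r k j - z (\<tau> k) j\<bar> \<le> 1 / \<tau> k" and ns: "\<And>k j. \<bar>s k j - z (\<tau> k) j\<bar> \<le> 1 / \<tau> k"
      and up: "\<And>k. r k i \<le> f (r k) i" and down: "\<And>k. f (s k) i \<le> s k i"
      by (simp_all only: straddles_def)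
    have to0: "(\<lambda>k. 1 / real (\<tau> k)) \<longlonglongrightarrow> 0"
    proof (rule tendsto_sandwich[OF _ _ tendsto_const lim_inverse_n'])
      show "\<forall>\<^sub>F k in sequentially. 1 / real (\<tau> k) \<le> 1 / real k"
        using eventually_gt_at_top[of 0] by eventually_elim (use \<tau>(2) in \<open>simp add: frac_le\<close>)
    qed simp
    have limit: "u \<longlonglongrightarrow> x" if "\<And>k j. \<bar>u k j - z (\<tau> k) j\<bar> \<le> 1 / \<tau> k" for u
      unfolding tendsto_coordinatewise_iff
    proof
      fix j
      have "(\<lambda>k. u k j - z (\<tau> k) j) \<longlonglongrightarrow> 0"
        by (rule Lim_null_comparison[OF _ to0]) (simp add: that)
      from tendsto_add[OF this limz[of j]] show "(\<lambda>k. u k j) \<longlonglongrightarrow> x j" by simp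
    qed
    have flimit: "(\<lambda>k. f (u k) i) \<longlonglongrightarrow> f x i" if "u \<longlonglongrightarrow> x" "\<And>k. u k \<in> hilbert_cube" for u
    proof -
      have "(\<lambda>k. f (u k)) \<longlonglongrightarrow> f x"
        by (rule continuous_on_tendsto_compose[OF cont that(1) x]) (use that(2) in auto)
      then show ?thesis by (simp add: tendsto_coordinatewise_iff)
    qed
    have coord: "(\<lambda>k. r k i) \<longlonglongrightarrow> x i" "(\<lambda>k. s k i) \<longlonglongrightarrow> x i"
      using limit[OF nr] limit[OF ns] unfolding tendsto_coordinatewise_iff by blast+
    have "x i \<le> f x i"
      using LIMSEQ_le[OF coord(1) flimit[OF limit[OF nr] r]] up by blast
    moreover have "f x i \<le> x i"
      using LIMSEQ_le[OF flimit[OF limit[OF ns] s] coord(2)] down by blast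
    ultimately show ?thesis by simp
  qed
  then show ?thesis using that x by blast
qed

section \<open>Open covers of a simplex\<close>

text \<open>The product of the standard simplex with \<open>m\<close> vertices and a free factor: sequences instead of
vectors of length \<open>m\<close> keep the number of vertices out of the type.\<close>

definition weights :: "nat \<Rightarrow> (nat \<Rightarrow> real) set" where
  "weights m = {t. (\<forall>k<m. 0 \<le> t k) \<and> (\<Sum>k<m. t k) = 1}"

text \<open>Brouwer's theorem in the form of a covering property. Pulled back along a retraction \<open>w\<close> of the
cube onto the simplex, the cover has a subordinate partition of unity, whose members are the
coordinates of a self-map of the cube. The weights \<open>t k\<close> of a fixed point \<open>t\<close> of this map are the
values at \<open>t\<close> of these members, and the \<open>k\<close>-th one vanishes outside the pullback of \<open>V k\<close>.\<close>

lemma simplex_open_cover_point: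
  assumes m: "m > 0"
    and V: "\<And>k. k < m \<Longrightarrow> openin (top_of_set (weights m)) (V k)"
    and cover: "weights m \<subseteq> (\<Union>k<m. V k)"
  obtains t where "t \<in> weights m" "\<And>k. k < m \<Longrightarrow> t k > 0 \<Longrightarrow> t \<in> V k"
proof -
  define S where "S t = (\<Sum>k<m. t k)" for t :: "nat \<Rightarrow> real"
  \<comment> \<open>Weights of total mass below \<open>1\<close> get the missing mass in equal parts, the others are rescaled.
    The result depends continuously on \<open>t\<close> and leaves weights of mass \<open>1\<close> alone.\<close>
  define w where "w t k = (if k < m then (t k + max 0 (1 - S t) / m) / max 1 (S t) else 0)"
    for t :: "nat \<Rightarrow> real" and k
  have w_weights: "w t \<in> weights m" if "t \<in> hilbert_cube" for t
  proof -
    have "(\<Sum>k<m. w t k) = (\<Sum>k<m. t k + max 0 (1 - S t) / m) / max 1 (S t)"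
      by (simp add: w_def sum_divide_distrib)
    also have "\<dots> = (S t + max 0 (1 - S t)) / max 1 (S t)"
      using m by (simp add: sum.distrib S_def)
    also have "\<dots> = 1" by (auto simp: max_def)
    finally show ?thesis using that by (simp add: weights_def w_def hilbert_cube_def)
  qed
  have cont_coord: "continuous_on hilbert_cube (\<lambda>t. t k)" for k :: nat
    by (rule continuous_on_subset[OF continuous_on_product_coordinates]) simp
  have cont_w: "continuous_on hilbert_cube w"
  proof (rule continuous_on_coordinatewise_then_product)
    fix k
    show "continuous_on hilbert_cube (\<lambda>t. w t k)"
      unfolding w_def S_def by (cases "k < m") (auto intro!: continuous_intros cont_coord)
  qed
  have "\<exists>U. open U \<and> {t \<in> hilbert_cube. w t \<in> V k} = hilbert_cube \<inter> U" if "k < m" for k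
  proof -
    have "continuous_map (top_of_set hilbert_cube) (top_of_set (weights m)) w"
      using cont_w w_weights by (auto simp: continuous_map_in_subtopology)
    from openin_continuous_map_preimage[OF this V[OF that]] show ?thesis
      by (simp add: openin_open)
  qed
  then obtain U where U: "\<And>k. k < m \<Longrightarrow> open (U k)"
    and UV: "\<And>k. k < m \<Longrightarrow> {t \<in> hilbert_cube. w t \<in> V k} = hilbert_cube \<inter> U k" by metis
  \<comment> \<open>The extra point, outside the cube, keeps the closed set nonempty if \<open>U k\<close> covers the cube; the
    distance to an empty set would be \<open>0\<close> instead of positive.\<close>
  define D where "D k = insert (\<lambda>_. 2) (hilbert_cube - U k)" for k
  define h where "h k t = infdist t (D k)" for k and t :: "nat \<Rightarrow> real"
  have D: "closed (D k)" if "k < m" for k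
    unfolding D_def using U[OF that] compact_imp_closed[OF compact_hilbert_cube]
    by (intro closed_insert closed_Diff)
  have h_nonneg: "0 \<le> h k t" for k t by (simp add: h_def infdist_nonneg)
  have h_pos: "0 < h k t \<longleftrightarrow> w t \<in> V k" if "k < m" "t \<in> hilbert_cube" for k t
  proof -
    have "t \<notin> D k \<longleftrightarrow> w t \<in> V k"
      using UV[OF that(1)] that(2) by (auto simp: D_def hilbert_cube_def)
    moreover have "t \<in> D k \<longleftrightarrow> h k t = 0"
      unfolding h_def using D[OF that(1)] by (intro in_closed_iff_infdist_zero) (auto simp: D_def)
    ultimately show ?thesis using h_nonneg[of k t] by auto
  qed
  have H_pos: "0 < (\<Sum>j<m. h j t)" if t: "t \<in> hilbert_cube" for t
  proof -
    obtain k where "k < m" "w t \<in> V k" using cover w_weights[OF t] by blast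
    then show ?thesis using h_pos[OF _ t] h_nonneg by (intro sum_pos2[of _ k]) auto
  qed
  define \<beta> where "\<beta> t k = (if k < m then h k t / (\<Sum>j<m. h j t) else 0)" for t k
  have "continuous_on hilbert_cube \<beta>"
  proof (rule continuous_on_coordinatewise_then_product)
    fix k
    have "\<forall>t\<in>hilbert_cube. (\<Sum>j<m. h j t) \<noteq> 0" using H_pos by force
    then show "continuous_on hilbert_cube (\<lambda>t. \<beta> t k)"
      unfolding \<beta>_def h_def by (cases "k < m") (auto intro!: continuous_intros)
  qed
  moreover have "\<beta> t \<in> hilbert_cube" if t: "t \<in> hilbert_cube" for t
    using H_pos[OF t] h_nonneg
    by (auto simp: \<beta>_def hilbert_cube_def divide_le_eq_1 intro!: member_le_sum divide_nonneg_pos)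
  ultimately obtain t where t: "t \<in> hilbert_cube" and fixed: "\<beta> t = t"
    by (rule hilbert_cube_fixed_point)
  have "(\<Sum>k<m. \<beta> t k) = 1"
    using H_pos[OF t] by (simp add: \<beta>_def flip: sum_divide_distrib)
  then have S: "S t = 1" by (simp add: S_def fixed)
  have wt: "w t = t"
  proof
    fix k show "w t k = t k"
      using fun_cong[OF fixed, of k] by (cases "k < m") (simp_all add: w_def S \<beta>_def)
  qed
  show ?thesis
  proof
    show "t \<in> weights m" using w_weights[OF t] wt by simp
    fix k assume k: "k < m" "t k > 0"
    then have "\<beta> t k > 0" by (simp add: fixed)
    then have "h k t > 0" using k H_pos[OF t] by (simp add: \<beta>_def zero_less_divide_iff)
    then show "t \<in> V k" using h_pos[OF k(1) t] wt by simp
  qed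
qed

section \<open>Topologies compatible with convex combinations\<close>

text \<open>This is what a convex set in a topological vector space retains of its surroundings: its
topology is coarser than the Euclidean one on every polytope spanned by points of the set. The
case \<open>m = 2\<close> makes \<open>topspace T\<close> convex, because convex combinations have to stay in it.\<close>

definition continuous_convex_combinations :: "'v::real_vector topology \<Rightarrow> bool" where
  "continuous_convex_combinations T \<longleftrightarrow>
     (\<forall>m p. (\<forall>k<m. p k \<in> topspace T) \<longrightarrow>
        continuous_map (top_of_set (weights m)) T (\<lambda>t. \<Sum>k<m. t k *\<^sub>R p k))"

lemma continuous_convex_combinations_subtopology:
  assumes T: "hausdorff_locally_convex_space T" and K: "convex K" "K \<subseteq> topspace T"
  shows "continuous_convex_combinations (subtopology T K)"
proof -
  have add: "continuous_map (prod_topology T T) T (\<lambda>(x, y). x + y)"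
    and scale: "continuous_map (prod_topology euclideanreal T) T (\<lambda>(r, x). r *\<^sub>R x)"
    and zero: "0 \<in> topspace T"
    using T by (auto simp: hausdorff_locally_convex_space_def subspace_0)
  have sums: "continuous_map euclidean T (\<lambda>t. \<Sum>k<m. t k *\<^sub>R p k)" if "\<forall>k<m. p k \<in> topspace T" for m :: nat and p
    using that
  proof (induction m)
    case 0
    then show ?case using zero by simp
  next
    case (Suc m)
    have "continuous_map euclidean (prod_topology euclideanreal T) (\<lambda>t. (t m, p m))"
      using Suc.prems by (intro continuous_map_pairedI) (auto simp: continuous_on_product_coordinates)
    then have "continuous_map euclidean T (\<lambda>t. t m *\<^sub>R p m)"
      using continuous_map_compose[OF _ scale] by (fastforce simp: o_def)
    with Suc have "continuous_map euclidean (prod_topology T T) (\<lambda>t. (\<Sum>k<m. t k *\<^sub>R p k, t m *\<^sub>R p m))"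
      by (intro continuous_map_pairedI) auto
    from continuous_map_compose[OF this add] show ?case by (simp add: o_def)
  qed
  show ?thesis
    unfolding continuous_convex_combinations_def
  proof (intro allI impI)
    fix m and p :: "nat \<Rightarrow> 'a" assume p: "\<forall>k<m. p k \<in> topspace (subtopology T K)"
    show "continuous_map (top_of_set (weights m)) (subtopology T K) (\<lambda>t. \<Sum>k<m. t k *\<^sub>R p k)"
      unfolding continuous_map_in_subtopology
    proof
      show "continuous_map (top_of_set (weights m)) T (\<lambda>t. \<Sum>k<m. t k *\<^sub>R p k)"
        using p by (intro continuous_map_from_subtopology sums) auto
      show "(\<lambda>t. \<Sum>k<m. t k *\<^sub>R p k) \<in> topspace (top_of_set (weights m)) \<rightarrow> K"
        using p K(1) by (auto simp: weights_def intro!: convex_sum)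
    qed
  qed
qed

lemma continuous_convex_combinations_prod:
  assumes S: "continuous_convex_combinations S" and T: "continuous_convex_combinations T"
  shows "continuous_convex_combinations (prod_topology S T)"
  unfolding continuous_convex_combinations_def
proof (intro allI impI)
  fix m and p :: "nat \<Rightarrow> 'a \<times> 'b" assume p: "\<forall>k<m. p k \<in> topspace (prod_topology S T)"
  then have "\<forall>k<m. fst (p k) \<in> topspace S" "\<forall>k<m. snd (p k) \<in> topspace T"
    by (auto simp: mem_Times_iff)
  then show "continuous_map (top_of_set (weights m)) (prod_topology S T) (\<lambda>t. \<Sum>k<m. t k *\<^sub>R p k)"
    using S T
    by (simp add: continuous_convex_combinations_def continuous_map_pairwise o_def fst_sum snd_sum)
qed

lemma continuous_convex_combinations_imp_connected:
  assumes T: "continuous_convex_combinations T"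
  shows "connected_space T"
proof (rule path_connected_imp_connected_space)
  show "path_connected_space T"
    unfolding path_connected_space_def
  proof (intro ballI)
    fix a b assume ab: "a \<in> topspace T" "b \<in> topspace T"
    define p where "p k = (if k = 0 then a else b)" for k :: nat
    define w where "w s k = (if k = 0 then 1 - s else s)" for s :: real and k :: nat
    have two: "{..<2} = {0, Suc 0}" by auto
    have cont: "continuous_on {0..1} w"
    proof (rule continuous_on_coordinatewise_then_product)
      fix k show "continuous_on {0..1} (\<lambda>s. w s k)"
        unfolding w_def by (cases "k = 0") (auto intro!: continuous_intros)
    qed
    have "w s \<in> weights 2" if "s \<in> {0..1}" for s
      using that by (auto simp: weights_def w_def two)
    with cont have "continuous_map (top_of_set {0..1}) (top_of_set (weights 2)) w"
      by (auto simp: continuous_map_in_subtopology)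
    moreover have "continuous_map (top_of_set (weights 2)) T (\<lambda>t. \<Sum>k<2. t k *\<^sub>R p k)"
      using T[unfolded continuous_convex_combinations_def, rule_format, of 2 p] ab
      by (simp add: p_def)
    ultimately have "pathin T ((\<lambda>t. \<Sum>k<2. t k *\<^sub>R p k) \<circ> w)"
      unfolding pathin_def by (rule continuous_map_compose)
    moreover have "((\<lambda>t. \<Sum>k<2. t k *\<^sub>R p k) \<circ> w) 0 = a" "((\<lambda>t. \<Sum>k<2. t k *\<^sub>R p k) \<circ> w) 1 = b"
      by (simp_all add: two p_def w_def)
    ultimately show "\<exists>g. pathin T g \<and> g 0 = a \<and> g 1 = b" by blast
  qed
qed

section \<open>Browder's fixed point theorem on a product\<close>

text \<open>Let \<open>U v\<close> be the open set of points \<open>y\<close> at which \<open>v\<close> selects from the values of \<open>G\<close>, that is,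
\<open>v i \<in> G i y\<close> for all \<open>i\<close>. Finitely many of these sets cover the compact product, say those of
\<open>p\<^sub>0, \<dots>, p\<^bsub>m-1\<^esub>\<close>. Pull them back along the map \<open>\<sigma>\<close> that sends weights to convex
combinations of the \<open>p\<^sub>k\<close>, and take the point \<open>t\<close> of the covering theorem:
every \<open>p\<^sub>k\<close> of positive weight is a selection at \<open>\<sigma> t\<close>, and the values are convex, so their
combination \<open>\<sigma> t\<close> is a selection at \<open>\<sigma> t\<close> as well.\<close>

theorem browder_fixed_point_product:
  fixes T :: "'i \<Rightarrow> 'v::real_vector topology" and G :: "'i \<Rightarrow> ('i \<Rightarrow> 'v) \<Rightarrow> 'v set"
  assumes I: "finite I"
    and comb: "\<And>i. i \<in> I \<Longrightarrow> continuous_convex_combinations (T i)"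
    and comp: "\<And>i. i \<in> I \<Longrightarrow> compact_space (T i)"
    and ne: "\<And>i. i \<in> I \<Longrightarrow> topspace (T i) \<noteq> {}"
    and G: "\<And>i y. i \<in> I \<Longrightarrow> y \<in> topspace (product_topology T I) \<Longrightarrow>
        G i y \<subseteq> topspace (T i) \<and> convex (G i y) \<and> G i y \<noteq> {}"
    and G_open: "\<And>i v. i \<in> I \<Longrightarrow> v \<in> topspace (T i) \<Longrightarrow>
        openin (product_topology T I) {y \<in> topspace (product_topology T I). v \<in> G i y}"
  obtains y where "y \<in> topspace (product_topology T I)" "\<And>i. i \<in> I \<Longrightarrow> y i \<in> G i y"
proof -
  let ?P = "product_topology T I"
  define U where "U v = {y \<in> topspace ?P. \<forall>i\<in>I. v i \<in> G i y}" for v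
  have U_open: "openin ?P (U v)" if "v \<in> topspace ?P" for v
  proof -
    have "U v = topspace ?P \<inter> (\<Inter>i\<in>I. {y \<in> topspace ?P. v i \<in> G i y})"
      by (auto simp: U_def)
    also have "openin ?P \<dots>"
    proof (intro openin_Int_Inter openin_topspace)
      fix W assume "W \<in> (\<lambda>i. {y \<in> topspace ?P. v i \<in> G i y}) ` I"
      then obtain i where i: "i \<in> I" "W = {y \<in> topspace ?P. v i \<in> G i y}" by blast
      with that have "v i \<in> topspace (T i)" by (auto simp: PiE_iff)
      with G_open i show "openin ?P W" by blast
    qed (use I in simp)
    finally show ?thesis .
  qed
  have U_cover: "\<exists>v\<in>topspace ?P. y \<in> U v" if y: "y \<in> topspace ?P" for y
  proof -
    have "\<forall>i\<in>I. \<exists>v. v \<in> G i y" using G[OF _ y] by blast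
    then obtain v where v: "\<And>i. i \<in> I \<Longrightarrow> v i \<in> G i y" by metis
    then have "restrict v I \<in> topspace ?P" "y \<in> U (restrict v I)"
      using G[OF _ y] y by (auto simp: U_def PiE_iff)
    then show ?thesis by blast
  qed
  have "compactin ?P (topspace ?P)"
    using comp unfolding compact_space_def[symmetric] by (simp add: compact_space_product_topology)
  moreover have "openin ?P W" if "W \<in> U ` topspace ?P" for W using that U_open by blast
  moreover have "topspace ?P \<subseteq> \<Union>(U ` topspace ?P)" using U_cover by blast
  ultimately have "\<exists>\<F>. finite \<F> \<and> \<F> \<subseteq> U ` topspace ?P \<and> topspace ?P \<subseteq> \<Union>\<F>"
    by (rule compactinD)
  then obtain \<F> where \<F>: "finite \<F>" "\<F> \<subseteq> U ` topspace ?P" "topspace ?P \<subseteq> \<Union>\<F>"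
    by iprover
  obtain B where B: "finite B" "B \<subseteq> topspace ?P" "topspace ?P \<subseteq> \<Union>(U ` B)"
    using finite_subset_image[OF \<F>(1,2)] \<F>(3) by blast
  obtain m :: nat and p where p: "B = p ` {..<m}"
    using finite_imp_nat_seg_image_inj_on[OF B(1)] by (metis lessThan_def)
  have p_in: "p k i \<in> topspace (T i)" if "k < m" "i \<in> I" for k i
    using B(2) p that by (auto simp: PiE_iff)
  have "topspace ?P \<noteq> {}" using ne by (simp add: PiE_eq_empty_iff)
  then have "m > 0" using B(3) p by (cases m) auto
  define \<sigma> where "\<sigma> t = (\<lambda>i\<in>I. \<Sum>k<m. t k *\<^sub>R p k i)" for t :: "nat \<Rightarrow> real"
  have \<sigma>: "continuous_map (top_of_set (weights m)) ?P \<sigma>"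
    unfolding continuous_map_componentwise
  proof (intro conjI ballI)
    show "\<sigma> ` topspace (top_of_set (weights m)) \<subseteq> extensional I" by (auto simp: \<sigma>_def)
    fix i assume i: "i \<in> I"
    then show "continuous_map (top_of_set (weights m)) (T i) (\<lambda>t. \<sigma> t i)"
      using comb[OF i] p_in by (simp add: \<sigma>_def continuous_convex_combinations_def)
  qed
  then have \<sigma>_in: "\<sigma> t \<in> topspace ?P" if "t \<in> weights m" for t
    using that continuous_map_image_subset_topspace by fastforce
  define V where "V k = {t \<in> weights m. \<sigma> t \<in> U (p k)}" for k
  obtain t where t: "t \<in> weights m" and tV: "\<And>k. k < m \<Longrightarrow> t k > 0 \<Longrightarrow> t \<in> V k"
  proof (rule simplex_open_cover_point[OF \<open>m > 0\<close>])
    fix k assume "k < m"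
    then show "openin (top_of_set (weights m)) (V k)"
      using openin_continuous_map_preimage[OF \<sigma> U_open, of "p k"] B(2) p by (simp add: V_def image_subset_iff)
  next
    show "weights m \<subseteq> (\<Union>k<m. V k)"
    proof
      fix t assume "t \<in> weights m"
      then show "t \<in> (\<Union>k<m. V k)" using \<sigma>_in[of t] B(3) p by (fastforce simp: V_def)
    qed
  qed blast
  show ?thesis
  proof
    show "\<sigma> t \<in> topspace ?P" by (rule \<sigma>_in[OF t])
    fix i assume i: "i \<in> I"
    let ?J = "{k. k < m \<and> t k > 0}"
    have drop: "(\<Sum>k<m. t k *\<^sub>R g k) = (\<Sum>k\<in>?J. t k *\<^sub>R g k)" for g :: "nat \<Rightarrow> 'x::real_vector"
      using t by (intro sum.mono_neutral_right) (auto simp: weights_def not_less antisym)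
    have "(\<Sum>k\<in>?J. t k *\<^sub>R p k i) \<in> G i (\<sigma> t)"
    proof (rule convex_sum)
      show "convex (G i (\<sigma> t))" using G[OF i \<sigma>_in[OF t]] by blast
      show "(\<Sum>k\<in>?J. t k) = 1" using t drop[of "\<lambda>_. 1::real"] by (simp add: weights_def)
      show "p k i \<in> G i (\<sigma> t)" if "k \<in> ?J" for k
        using tV[of k] that i by (auto simp: V_def U_def)
    qed auto
    then show "\<sigma> t i \<in> G i (\<sigma> t)" using i drop[of "\<lambda>k. p k i"] by (simp add: \<sigma>_def)
  qed
qed

section \<open>Games in choice form\<close>

lemma opp_update:
  assumes "z \<in> opp_profiles n X i"
  shows "opp n i (z(i := a)) = z"
  using assms by (auto simp: opp_def opp_profiles_def PiE_iff extensional_def fun_eq_iff)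

lemma update_opp:
  assumes "x \<in> profiles n X"
  shows "(opp n i x)(i := x i) = x"
  using assms by (auto simp: opp_def profiles_def PiE_iff extensional_def fun_eq_iff)

text \<open>A pair in \<open>C i\<close> satisfies the constraints, as \<open>C i\<close> lies in the product of the graphs. Hence
a section at opponents' profiles \<open>z\<close>, \<open>w\<close> meets \<open>A i z \<times> F i w\<close> as soon as it is nonempty. In this form
the domain is visibly open if the sections at own strategies are.\<close>

lemma choice_domain_eq_Union:
  assumes game: "generalized_game_in_choice_form n X A F C" and i: "i \<in> {1..n}"
  shows "choice_domain n X A F C i = (\<Union>a\<in>X i. \<Union>b\<in>X i. section_at_own n X C i a b)"
proof -
  have "a \<in> A i z \<and> b \<in> F i w"
    if "z \<in> opp_profiles n X i" "w \<in> opp_profiles n X i" "(z(i := a), w(i := b)) \<in> C i" for z w a b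
  proof -
    have "(z(i := a), w(i := b)) \<in> graph_of n X i (A i) \<times> graph_of n X i (F i)"
      using game i that(3) by (auto simp: generalized_game_in_choice_form_def)
    then show ?thesis by (simp add: graph_of_def opp_update[OF that(1)] opp_update[OF that(2)])
  qed
  then show ?thesis
    by (simp add: choice_domain_def section_at_opp_def section_at_own_def set_eq_iff) blast
qed


text \<open>The domain is closed by hypothesis and open as a union of open sections. Being nonempty, it is
all of the connected space of pairs of opponents' profiles.\<close>

lemma section_at_opp_nonempty:
  assumes game: "generalized_game_in_choice_form n X A F C" and i: "i \<in> {1..n}"
    and conn: "\<And>j. j \<in> {1..n} \<Longrightarrow> connected_space (subtopology (T j) (X j))"
    and X: "\<And>j. j \<in> {1..n} \<Longrightarrow> X j \<subseteq> topspace (T j)"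
    and domain: "choice_domain n X A F C i \<noteq> {}"
      "closedin (prod_topology (opp_topology n T X i) (opp_topology n T X i)) (choice_domain n X A F C i)"
    and open_sections: "\<And>a b. a \<in> X i \<Longrightarrow> b \<in> X i \<Longrightarrow>
      openin (prod_topology (opp_topology n T X i) (opp_topology n T X i)) (section_at_own n X C i a b)"
    and zw: "z \<in> opp_profiles n X i" "w \<in> opp_profiles n X i"
  shows "section_at_opp X C i z w \<noteq> {}"
proof -
  let ?O = "prod_topology (opp_topology n T X i) (opp_topology n T X i)"
  have "connected_space ?O"
    using conn by (simp add: opp_topology_def connected_space_prod_topology connected_space_product_topology)
  moreover have "openin ?O (choice_domain n X A F C i)"
    unfolding choice_domain_eq_Union[OF game i] using open_sections by blast
  ultimately have "choice_domain n X A F C i = topspace ?O"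
    using domain unfolding connected_space_clopen_in by blast
  also have "topspace ?O = opp_profiles n X i \<times> opp_profiles n X i"
    using X by (auto simp: opp_topology_def opp_profiles_def PiE_iff subset_iff)
  finally show ?thesis using zw by (auto simp: choice_domain_def)
qed

theorem theorem1:
  fixes n :: nat
    and T :: "nat \<Rightarrow> 'e::real_vector topology"
    and X :: "nat \<Rightarrow> 'e set"
    and A F :: "nat \<Rightarrow> (nat \<Rightarrow> 'e) \<Rightarrow> 'e set"
    and C :: "nat \<Rightarrow> ((nat \<Rightarrow> 'e) \<times> (nat \<Rightarrow> 'e)) set"
  assumes game: "generalized_game_in_choice_form n X A F C"
    and some_choice: "\<And>x y. x \<in> profiles n X \<Longrightarrow> y \<in> profiles n X \<Longrightarrow>
          \<exists>i\<in>{1..n}. section_at_opp X C i (opp n i x) (opp n i y) \<noteq> {}"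
    and lcs: "\<And>i. i \<in> {1..n} \<Longrightarrow> hausdorff_locally_convex_space (T i)"
    and strategies: "\<And>i. i \<in> {1..n} \<Longrightarrow> X i \<noteq> {} \<and> convex (X i) \<and> compactin (T i) (X i)"
    and domain: "\<And>i. i \<in> {1..n} \<Longrightarrow>
          choice_domain n X A F C i \<noteq> {} \<and>
          closedin (prod_topology (opp_topology n T X i) (opp_topology n T X i))
            (choice_domain n X A F C i)"
    and open_sections: "\<And>i a b. i \<in> {1..n} \<Longrightarrow> a \<in> X i \<Longrightarrow> b \<in> X i \<Longrightarrow>
          openin (prod_topology (opp_topology n T X i) (opp_topology n T X i))
            (section_at_own n X C i a b)"
    and convex_sections: "\<And>i z w. i \<in> {1..n} \<Longrightarrow>
          z \<in> opp_profiles n X i \<Longrightarrow> w \<in> opp_profiles n X i \<Longrightarrow>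
          convex (section_at_opp X C i z w) \<or> section_at_opp X C i z w = {}"
  shows "\<exists>x y. equilibrium_in_choice n X A F C x y"
proof -
  have X_sub: "X i \<subseteq> topspace (T i)" if "i \<in> {1..n}" for i
    using strategies[OF that] compactin_subset_topspace by blast
  have comb: "continuous_convex_combinations (subtopology (T i) (X i))" if "i \<in> {1..n}" for i
    using continuous_convex_combinations_subtopology lcs[OF that] strategies[OF that] X_sub[OF that]
    by blast
  have ne: "section_at_opp X C i z w \<noteq> {}"
    if "i \<in> {1..n}" "z \<in> opp_profiles n X i" "w \<in> opp_profiles n X i" for i z w
    using section_at_opp_nonempty[where T = T, OF game that(1) _ X_sub] comb
      continuous_convex_combinations_imp_connected domain[OF that(1)] open_sections[OF that(1)] that(2,3)
    by blast
  \<comment> \<open>Player \<open>i\<close> picks the pair \<open>(x i, y i)\<close>, so that the pair of profiles \<open>(x, y)\<close> is one point of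
    the product of the squares \<open>X i \<times> X i\<close>.\<close>
  define R where "R i = prod_topology (subtopology (T i) (X i)) (subtopology (T i) (X i))" for i
  have topR: "topspace (R i) = X i \<times> X i" if "i \<in> {1..n}" for i
    using X_sub[OF that] by (auto simp: R_def)
  define P where "P = product_topology R {1..n}"
  define x where "x v = (\<lambda>j\<in>{1..n}. fst (v j))" for v :: "nat \<Rightarrow> 'e \<times> 'e"
  define y where "y v = (\<lambda>j\<in>{1..n}. snd (v j))" for v :: "nat \<Rightarrow> 'e \<times> 'e"
  have topP: "topspace P = (\<Pi>\<^sub>E j\<in>{1..n}. X j \<times> X j)"
    using topR by (auto simp: P_def intro!: PiE_cong)
  have profiles: "x v \<in> profiles n X" "y v \<in> profiles n X" if "v \<in> topspace P" for v
    using that by (auto simp: topP x_def y_def profiles_def PiE_iff mem_Times_iff)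
  have opps: "opp n i (x v) \<in> opp_profiles n X i" "opp n i (y v) \<in> opp_profiles n X i"
    if "v \<in> topspace P" for i v
    using profiles[OF that] by (auto simp: opp_def opp_profiles_def profiles_def PiE_iff)
  have cont: "continuous_map P (prod_topology (opp_topology n T X i) (opp_topology n T X i))
      (\<lambda>v. (opp n i (x v), opp n i (y v)))" for i
  proof (rule continuous_map_pairedI)
    have proj: "continuous_map P (R j) (\<lambda>v. v j)" if "j \<in> {1..n}" for j
      unfolding P_def using that by (rule continuous_map_product_projection)
    have coord: "continuous_map P (subtopology (T j) (X j)) (\<lambda>v. fst (v j))"
      "continuous_map P (subtopology (T j) (X j)) (\<lambda>v. snd (v j))" if "j \<in> {1..n}" for j
      using proj[OF that] by (simp_all add: R_def continuous_map_pairwise o_def)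
    show "continuous_map P (opp_topology n T X i) (\<lambda>v. opp n i (x v))"
      "continuous_map P (opp_topology n T X i) (\<lambda>v. opp n i (y v))"
      unfolding opp_topology_def continuous_map_componentwise
      using coord by (auto simp: opp_def x_def y_def)
  qed
  define G where "G i v = section_at_opp X C i (opp n i (x v)) (opp n i (y v))" for i v
  obtain v where v: "v \<in> topspace P" and fixed: "\<And>i. i \<in> {1..n} \<Longrightarrow> v i \<in> G i v"
  proof (rule browder_fixed_point_product[of "{1..n}" R G, folded P_def])
    fix i assume i: "i \<in> {1..n}"
    show "continuous_convex_combinations (R i)"
      unfolding R_def using comb[OF i] by (intro continuous_convex_combinations_prod)
    show "compact_space (R i)"
      using strategies[OF i] by (simp add: R_def compact_space_prod_topology compact_space_subtopology)
    show "topspace (R i) \<noteq> {}" using strategies[OF i] by (simp add: topR[OF i])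
    fix v assume v: "v \<in> topspace P"
    have "G i v \<subseteq> topspace (R i)" by (auto simp: topR[OF i] G_def section_at_opp_def)
    moreover have "convex (G i v)" "G i v \<noteq> {}"
      using ne[OF i opps[OF v]] convex_sections[OF i opps[OF v]] by (simp_all add: G_def)
    ultimately show "G i v \<subseteq> topspace (R i) \<and> convex (G i v) \<and> G i v \<noteq> {}" by blast
  next
    fix i ab assume i: "i \<in> {1..n}" and "ab \<in> topspace (R i)"
    then obtain a b where ab: "ab = (a, b)" "a \<in> X i" "b \<in> X i" using topR by auto
    have "{v \<in> topspace P. ab \<in> G i v} =
        {v \<in> topspace P. (opp n i (x v), opp n i (y v)) \<in> section_at_own n X C i a b}"
      using ab opps by (auto simp: G_def section_at_opp_def section_at_own_def)
    also have "openin P \<dots>"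
      by (rule openin_continuous_map_preimage[OF cont open_sections[OF i ab(2,3)]])
    finally show "openin P {v \<in> topspace P. ab \<in> G i v}" .
  qed auto
  have "(x v, y v) \<in> C i" if i: "i \<in> {1..n}" for i
  proof -
    have "((opp n i (x v))(i := x v i), (opp n i (y v))(i := y v i)) \<in> C i"
      using fixed[OF i] i by (auto simp: G_def section_at_opp_def x_def y_def)
    then show ?thesis using update_opp profiles[OF v] by metis
  qed
  then show ?thesis
    using profiles[OF v] unfolding equilibrium_in_choice_def by blast
qed

end
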